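(* Let $C\subset\mathbb{R}^n$ be nonempty, closed and convex and let $D=\{x\in\mathbb{R}^n: Ax=b\}$ be a nonempty affine set, where $A$ is a linear operator. Let $\alpha_1,\alpha_2\in(0,2]$. Let $\mathcal{N}(A)$ denote the nullspace of $A$ and $\mathcal{R}(A^* )$ its orthogonal complement, the range space of $A^*$. Then the GAP envelope $F_{\alpha_1,\alpha_2}^{\mathrm{GAP}}$ (defined in the context) is convex and $\alpha_2$-smooth when restricted to $\mathcal{N}(A)$. If $\alpha_1\in[1,2]$, the GAP envelope is concave and $\alpha_1(\alpha_1-1)$-smooth when restricted to $\mathcal{R}(A^* )$.
   Context: $\langle\cdot,\cdot\rangle$ is an inner product on $\mathbb{R}^n$ with induced norm $\|\cdot\|$; $\Pi_C$ is the projection onto a nonempty closed convex set $C$ and $\iota_C$ its indicator function. Put $r_C(x)=\iota_C(x)+\tfrac12\|x\|^2$, with conjugate $r_C^*(y)=\sup_x\{\langle y,x\rangle-r_C(x)\}$, for which $\nabla r_C^*=\Pi_C$. Define $p_C^\alpha(x)=\alpha r_C^*(x)+\tfrac{1-\alpha}2\|x\|^2$ and the relaxed projection $P_C^\alpha(x)=\nabla p_C^\alpha(x)=\alpha\Pi_C(x)+(1-\alpha)x$. For the affine set $D=\{x:Ax=b\}$ let $N=\Pi_{D_0}$ with $D_0=\{x:Ax=0\}$, and let $P=(1-\alpha_1)\mathrm{Id}+\alpha_1N$ (the linear part of the affine map $P_D^{\alpha_1}$). The GAP (generalized alternating projections) envelope is $$F_{\alpha_1,\alpha_2}^{\mathrm{GAP}}(x)=\tfrac12\langle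 Px,x\rangle-p_C^{\alpha_2}(P_D^{\alpha_1}x).$$ A differentiable function $F$ is $\beta$-smooth ($\beta\geq 0$) when restricted to a linear subspace $V$ if $-\tfrac\beta2\|x-y\|^2\le F(x)-F(y)-\langle\nabla F(y),x-y\rangle\le\tfrac\beta2\|x-y\|^2$ for all $x,y\in V$. *)

theory Defs
  imports "HOL-Analysis.Analysis"
begin

definition indicator_fun :: "'a set \<Rightarrow> 'a \<Rightarrow> ereal" where
  "indicator_fun C x = (if x \<in> C then 0 else \<infinity>)"

definition conjugate :: "('a::real_inner \<Rightarrow> ereal) \<Rightarrow> 'a \<Rightarrow> ereal" where
  "conjugate f y = (SUP x. ereal (y \<bullet> x) - f x)"

definition r_fun :: "'a::real_inner set \<Rightarrow> 'a \<Rightarrow> ereal" where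
  "r_fun C x = indicator_fun C x + ereal ((norm x)\<^sup>2 / 2)"

text \<open>The conversion to the reals below loses nothing: the conjugate is finite for nonempty \<open>C\<close>.\<close>

lemma conjugate_r_fun_finite:
  fixes C :: "'a::real_inner set"
  assumes "C \<noteq> {}"
  shows "\<bar>conjugate (r_fun C) y\<bar> \<noteq> \<infinity>"
proof -
  obtain c where c: "c \<in> C" using assms by blast
  have "ereal (y \<bullet> x) - r_fun C x \<le> ereal ((norm y)\<^sup>2 / 2)" for x
  proof (cases "x \<in> C")
    case True
    have "0 \<le> (norm (y - x))\<^sup>2" by simp
    then have "y \<bullet> x - (norm x)\<^sup>2 / 2 \<le> (norm y)\<^sup>2 / 2"
      by (simp add: power2_norm_eq_inner algebra_simps inner_commute)
    then show ?thesis using True by (simp add: r_fun_def indicator_fun_def)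
  next
    case False
    then show ?thesis by (simp add: r_fun_def indicator_fun_def)
  qed
  then have up: "conjugate (r_fun C) y \<le> ereal ((norm y)\<^sup>2 / 2)"
    unfolding conjugate_def by (intro SUP_least)
  have "ereal (y \<bullet> c) - r_fun C c \<le> conjugate (r_fun C) y"
    unfolding conjugate_def by (intro SUP_upper) simp
  then have "ereal (y \<bullet> c - (norm c)\<^sup>2 / 2) \<le> conjugate (r_fun C) y"
    using c by (simp add: r_fun_def indicator_fun_def)
  with up show ?thesis by (cases "conjugate (r_fun C) y") auto
qed

definition p_fun :: "real \<Rightarrow> 'a::real_inner set \<Rightarrow> 'a \<Rightarrow> real" where
  "p_fun \<alpha> C x = \<alpha> * real_of_ereal (conjugate (r_fun C) x) + (1 - \<alpha>) / 2 * (norm x)\<^sup>2"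

definition relaxed_proj :: "real \<Rightarrow> 'a::euclidean_space set \<Rightarrow> 'a \<Rightarrow> 'a" where
  "relaxed_proj \<alpha> C x = \<alpha> *\<^sub>R closest_point C x + (1 - \<alpha>) *\<^sub>R x"

definition lin_part :: "('a::euclidean_space \<Rightarrow> 'b::euclidean_space) \<Rightarrow> real \<Rightarrow> 'a \<Rightarrow> 'a" where
  "lin_part A \<alpha> x = (1 - \<alpha>) *\<^sub>R x + \<alpha> *\<^sub>R closest_point {z. A z = 0} x"

definition gap_envelope ::
  "('a::euclidean_space \<Rightarrow> 'b::euclidean_space) \<Rightarrow> 'b \<Rightarrow> 'a set \<Rightarrow> real \<Rightarrow> real \<Rightarrow> 'a \<Rightarrow> real" where
  "gap_envelope A b C \<alpha>1 \<alpha>2 x =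
     (lin_part A \<alpha>1 x \<bullet> x) / 2 - p_fun \<alpha>2 C (relaxed_proj \<alpha>1 {z. A z = b} x)"

text \<open>Differentiability is required on the whole space, and the gradient is that of the
  unrestricted function; only the two-sided bound is restricted to the subspace \<open>V\<close>.\<close>

definition smooth_restricted :: "real \<Rightarrow> 'a::real_inner set \<Rightarrow> ('a \<Rightarrow> real) \<Rightarrow> bool" where
  "smooth_restricted \<beta> V F \<longleftrightarrow> 0 \<le> \<beta> \<and>
     (\<exists>G. (\<forall>x. GDERIV F x :> G x) \<and>
       (\<forall>x\<in>V. \<forall>y\<in>V.
          - (\<beta> / 2) * (norm (x - y))\<^sup>2 \<le> F x - F y - G y \<bullet> (x - y) \<and>
          F x - F y - G y \<bullet> (x - y) \<le> \<beta> / 2 * (norm (x - y))\<^sup>2))"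

end

theory Submission
  imports Defs
begin

text \<open>With \<open>N\<close> the orthogonal projection onto the nullspace of \<open>A\<close>, both \<open>P = (1 - \<alpha>1) Id + \<alpha>1 N\<close>
  and the relaxed projection \<open>T\<close> onto \<open>{x. A x = b}\<close> satisfy \<open>T x - T y = P (x - y)\<close>, and \<open>P\<close> is
  self-adjoint. Since \<open>p_fun \<alpha> C x = (\<parallel>x\<parallel>\<^sup>2 - \<alpha> d(x, C)\<^sup>2) / 2\<close>, and half the squared distance is
  convex and \<open>1\<close>-smooth with gradient \<open>x - \<Pi> x\<close>, the Bregman distance of the GAP envelope at
  \<open>h = x - y\<close> lies between \<open>(P h \<bullet> h - \<parallel>P h\<parallel>\<^sup>2) / 2\<close> and \<open>(P h \<bullet> h - (1 - \<alpha>2) \<parallel>P h\<parallel>\<^sup>2) / 2\<close>. On the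
  nullspace \<open>P h = h\<close>, and on the range of the adjoint \<open>P h = (1 - \<alpha>1) h\<close>; all the claims follow.\<close>

section \<open>From two-sided Bregman bounds to gradients and convexity\<close>

text \<open>Divided by \<open>norm (x - y)\<close>, the remainder is at most
  \<open>K * norm (x - y)\<close> and tends to 0. Differentiability of the envelope can thus be read
  off from its Bregman bounds, without differentiating a conjugate or a projection.\<close>

lemma GDERIV_quadratic_bound:
  fixes f :: "'a::real_inner \<Rightarrow> real"
  assumes "\<And>x. \<bar>f x - f y - g \<bullet> (x - y)\<bar> \<le> K * (norm (x - y))\<^sup>2"
  shows "GDERIV f y :> g"
  unfolding gderiv_def
proof (rule has_derivativeI_sandwich[where e = 1])
  show "bounded_linear (\<lambda>h. h \<bullet> g)"
    by (rule bounded_linear_inner_left)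
  have "((\<lambda>x. K * norm (x - y)) \<longlongrightarrow> K * norm (y - y)) (at y)"
    by (intro tendsto_intros)
  then show "((\<lambda>x. K * norm (x - y)) \<longlongrightarrow> 0) (at y)"
    by simp
  fix x assume "x \<noteq> y"
  then show "norm (f x - f y - (x - y) \<bullet> g) / norm (x - y) \<le> K * norm (x - y)"
    using assms[of x] by (simp add: divide_simps inner_commute power2_eq_square mult.assoc)
qed simp

text \<open>At the convex combination \<open>z\<close> of \<open>x\<close> and \<open>y\<close>,
  \<open>F\<close> is supported from below by an affine function of slope \<open>G z\<close>.
  Averaging the support inequalities at \<open>x\<close> and \<open>y\<close> cancels the slope,
  since the weighted displacements from \<open>z\<close> sum to 0.\<close>

lemma convex_on_Bregman_nonneg:
  fixes F :: "'a::real_inner \<Rightarrow> real"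
  assumes "convex S"
    and nonneg: "\<And>x y. x \<in> S \<Longrightarrow> y \<in> S \<Longrightarrow> 0 \<le> F x - F y - G y \<bullet> (x - y)"
  shows "convex_on S F"
proof (rule convex_onI)
  fix t :: real and x y
  assume t: "0 < t" "t < 1" and S: "x \<in> S" "y \<in> S"
  define z where "z = (1 - t) *\<^sub>R x + t *\<^sub>R y"
  have "z \<in> S"
    unfolding z_def using assms(1) S t by (intro convexD) auto
  then have "0 \<le> (1 - t) * (F x - F z - G z \<bullet> (x - z)) + t * (F y - F z - G z \<bullet> (y - z))"
    using nonneg S t by simp
  also have "\<dots> = (1 - t) * F x + t * F y - F z - G z \<bullet> ((1 - t) *\<^sub>R (x - z) + t *\<^sub>R (y - z))"
    by (simp add: inner_right_distrib algebra_simps)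
  also have "(1 - t) *\<^sub>R (x - z) + t *\<^sub>R (y - z) = 0"
    by (simp add: z_def algebra_simps)
  finally show "F ((1 - t) *\<^sub>R x + t *\<^sub>R y) \<le> (1 - t) * F x + t * F y"
    by (simp add: z_def)
qed (rule assms(1))

section \<open>Squared distance, conjugate and relaxed projection for a convex set\<close>

text \<open>Lower bound: the Bregman distance is half a square minus
  \<open>(y - q) \<bullet> (p - q)\<close>, which is nonpositive by the obtuse-angle property of the
  projection \<open>q\<close> of \<open>y\<close>. Upper bound: \<open>q\<close> is a competitor for
  the projection of \<open>x\<close>, so \<open>norm (x - p)\<close> is at most
  \<open>norm (x - q)\<close>, whose square is expanded around \<open>y\<close>.\<close>

lemma half_sq_dist_Bregman:
  fixes C :: "'a::euclidean_space set"
  assumes "C \<noteq> {}" "closed C" "convex C"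
  defines "d \<equiv> \<lambda>x. (norm (x - closest_point C x))\<^sup>2 / 2"
  shows "0 \<le> d x - d y - (y - closest_point C y) \<bullet> (x - y)"
    and "d x - d y - (y - closest_point C y) \<bullet> (x - y) \<le> (norm (x - y))\<^sup>2 / 2"
proof -
  define p q where "p = closest_point C x" and "q = closest_point C y"
  have C: "p \<in> C" "q \<in> C"
    using assms by (auto simp: p_def q_def closest_point_in_set)
  have "d x - d y - (y - q) \<bullet> (x - y) = (norm ((x - p) - (y - q)))\<^sup>2 / 2 - (y - q) \<bullet> (p - q)"
    unfolding d_def p_def[symmetric] q_def[symmetric]
    by (simp add: power2_norm_eq_inner inner_commute algebra_simps field_simps)
  moreover have "(y - q) \<bullet> (p - q) \<le> 0"
    unfolding q_def using assms C by (intro closest_point_dot)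
  moreover have "0 \<le> (norm ((x - p) - (y - q)))\<^sup>2 / 2"
    by simp
  ultimately show "0 \<le> d x - d y - (y - closest_point C y) \<bullet> (x - y)"
    unfolding q_def by linarith
  have "norm (x - p) \<le> norm (x - q)"
    using closest_point_le[OF assms(2) C(2), of x] by (simp add: p_def dist_norm)
  then have "(norm (x - p))\<^sup>2 \<le> (norm (x - q))\<^sup>2"
    by simp
  also have "\<dots> = (norm (x - y))\<^sup>2 + 2 * ((y - q) \<bullet> (x - y)) + (norm (y - q))\<^sup>2"
    by (simp add: power2_norm_eq_inner inner_commute algebra_simps)
  finally show "d x - d y - (y - closest_point C y) \<bullet> (x - y) \<le> (norm (x - y))\<^sup>2 / 2"
    by (simp add: d_def p_def q_def)
qed

text \<open>Completing the square turns the supremum over \<open>C\<close> into a minimization of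
  the distance to \<open>y\<close>, attained at the projection; points outside \<open>C\<close>
  contribute minus infinity.\<close>

lemma conjugate_r_fun:
  fixes C :: "'a::euclidean_space set"
  assumes "C \<noteq> {}" "closed C"
  shows "conjugate (r_fun C) y = ereal ((norm y)\<^sup>2 / 2 - (norm (y - closest_point C y))\<^sup>2 / 2)"
proof -
  have val: "ereal (y \<bullet> x) - r_fun C x = ereal ((norm y)\<^sup>2 / 2 - (norm (y - x))\<^sup>2 / 2)"
    if "x \<in> C" for x
    using that by (simp add: r_fun_def indicator_fun_def power2_norm_eq_inner inner_commute
        algebra_simps field_simps)
  have p: "closest_point C y \<in> C"
    using assms by (simp add: closest_point_in_set)
  show ?thesis
    unfolding conjugate_def
  proof (rule antisym)
    show "(SUP x. ereal (y \<bullet> x) - r_fun C x)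
        \<le> ereal ((norm y)\<^sup>2 / 2 - (norm (y - closest_point C y))\<^sup>2 / 2)"
    proof (rule SUP_least)
      fix x
      show "ereal (y \<bullet> x) - r_fun C x
          \<le> ereal ((norm y)\<^sup>2 / 2 - (norm (y - closest_point C y))\<^sup>2 / 2)"
      proof (cases "x \<in> C")
        case True
        then have "norm (y - closest_point C y) \<le> norm (y - x)"
          using closest_point_le[OF assms(2), of x y] by (simp add: dist_norm)
        then show ?thesis
          by (simp add: val[OF True] divide_right_mono)
      qed (simp add: r_fun_def indicator_fun_def)
    qed
    show "ereal ((norm y)\<^sup>2 / 2 - (norm (y - closest_point C y))\<^sup>2 / 2)
        \<le> (SUP x. ereal (y \<bullet> x) - r_fun C x)"
      unfolding val[OF p, symmetric] by (rule SUP_upper) simp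
  qed
qed

lemma p_fun_Bregman:
  fixes C :: "'a::euclidean_space set"
  assumes "C \<noteq> {}" "closed C" "convex C" "0 \<le> \<alpha>"
  shows "(1 - \<alpha>) * (norm (x - y))\<^sup>2 / 2 \<le> p_fun \<alpha> C x - p_fun \<alpha> C y - relaxed_proj \<alpha> C y \<bullet> (x - y)"
    and "p_fun \<alpha> C x - p_fun \<alpha> C y - relaxed_proj \<alpha> C y \<bullet> (x - y) \<le> (norm (x - y))\<^sup>2 / 2"
proof -
  define B where "B = (norm (x - closest_point C x))\<^sup>2 / 2 - (norm (y - closest_point C y))\<^sup>2 / 2
    - (y - closest_point C y) \<bullet> (x - y)"
  have p: "p_fun \<alpha> C z = (norm z)\<^sup>2 / 2 - \<alpha> * ((norm (z - closest_point C z))\<^sup>2 / 2)" for z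
    by (simp add: p_fun_def conjugate_r_fun[OF assms(1,2)] field_simps)
  have R: "relaxed_proj \<alpha> C y = y - \<alpha> *\<^sub>R (y - closest_point C y)"
    by (simp add: relaxed_proj_def algebra_simps)
  have sq: "(norm (x - y))\<^sup>2 / 2 = (norm x)\<^sup>2 / 2 - (norm y)\<^sup>2 / 2 - y \<bullet> (x - y)"
    by (simp add: power2_norm_eq_inner inner_commute algebra_simps field_simps)
  \<comment> \<open>Bregman distances are linear in the function: half the squared norm contributes
    exactly \<open>(norm (x - y))\<^sup>2 / 2\<close>, and half the squared distance to
    \<open>C\<close> contributes \<open>B\<close>.\<close>
  have eq: "p_fun \<alpha> C x - p_fun \<alpha> C y - relaxed_proj \<alpha> C y \<bullet> (x - y)
      = (norm (x - y))\<^sup>2 / 2 - \<alpha> * B"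
    by (simp only: p R sq B_def inner_diff_left inner_scaleR_left right_diff_distrib)
  have "0 \<le> B" "B \<le> (norm (x - y))\<^sup>2 / 2"
    using half_sq_dist_Bregman[OF assms(1-3)] by (auto simp: B_def)
  then have "0 \<le> \<alpha> * B" "\<alpha> * B \<le> \<alpha> * ((norm (x - y))\<^sup>2 / 2)"
    using assms(4) by (auto simp del: times_divide_eq_right intro!: mult_left_mono)
  then show "(1 - \<alpha>) * (norm (x - y))\<^sup>2 / 2
        \<le> p_fun \<alpha> C x - p_fun \<alpha> C y - relaxed_proj \<alpha> C y \<bullet> (x - y)"
    and "p_fun \<alpha> C x - p_fun \<alpha> C y - relaxed_proj \<alpha> C y \<bullet> (x - y) \<le> (norm (x - y))\<^sup>2 / 2"
    unfolding eq by (auto simp: field_simps)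
qed

section \<open>Projections onto translates and onto subspaces\<close>

lemma closest_point_translation:
  fixes S :: "'a::euclidean_space set"
  assumes "convex S" "closed S" "S \<noteq> {}"
  shows "closest_point ((+) a ` S) (a + x) = a + closest_point S x"
proof (rule closest_point_unique[symmetric])
  show "convex ((+) a ` S)" "closed ((+) a ` S)"
    using assms by (auto intro: convex_translation closed_translation)
  show "a + closest_point S x \<in> (+) a ` S"
    using assms by (simp add: closest_point_in_set)
  show "\<forall>z\<in>(+) a ` S. dist (a + x) (a + closest_point S x) \<le> dist (a + x) z"
    using assms by (auto intro: closest_point_le)
qed

text \<open>In a subspace the obtuse-angle inequality may be tested in the directions
  \<open>w\<close> and \<open>- w\<close>, which forces equality.\<close>

lemma closest_point_subspace_orthogonal:
  fixes S :: "'a::euclidean_space set"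
  assumes "subspace S" "w \<in> S"
  shows "(x - closest_point S x) \<bullet> w = 0"
proof -
  note S = closed_subspace[OF assms(1)] subspace_imp_convex[OF assms(1)]
  have p: "closest_point S x \<in> S"
    using S(1) assms(2) by (auto intro: closest_point_in_set)
  have "(x - closest_point S x) \<bullet> (closest_point S x + v - closest_point S x) \<le> 0" if "v \<in> S" for v
    using S p that assms(1) by (intro closest_point_dot) (auto intro: subspace_add)
  from this[of w] this[of "- w"] show ?thesis
    using assms by (simp add: subspace_neg)
qed

text \<open>The difference of the two candidates lies in \<open>S\<close>, while both residuals are
  orthogonal to \<open>S\<close>; hence it is orthogonal to itself.\<close>

lemma closest_point_subspace_eqI:
  fixes S :: "'a::euclidean_space set"
  assumes "subspace S" "p \<in> S" "\<And>w. w \<in> S \<Longrightarrow> (x - p) \<bullet> w = 0"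
  shows "closest_point S x = p"
proof -
  let ?q = "closest_point S x"
  have q: "?q \<in> S"
    using closed_subspace[OF assms(1)] assms(2) by (auto intro: closest_point_in_set)
  then have d: "?q - p \<in> S"
    using assms by (simp add: subspace_diff)
  have "(?q - p) \<bullet> (?q - p) = (x - p) \<bullet> (?q - p) - (x - ?q) \<bullet> (?q - p)"
    by (simp add: inner_diff_left)
  also have "\<dots> = 0"
    using assms(3)[OF d] closest_point_subspace_orthogonal[OF assms(1) d] by simp
  finally show ?thesis
    by simp
qed

lemma linear_closest_point_subspace:
  fixes S :: "'a::euclidean_space set"
  assumes "subspace S"
  shows "linear (closest_point S)"
proof (rule linearI)
  have p: "closest_point S x \<in> S" for x
    using closed_subspace[OF assms] subspace_0[OF assms] by (auto intro: closest_point_in_set)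
  note orth = closest_point_subspace_orthogonal[OF assms]
  show "closest_point S (x + y) = closest_point S x + closest_point S y" for x y
  proof (rule closest_point_subspace_eqI[OF assms subspace_add[OF assms p p]])
    fix w assume "w \<in> S"
    then show "(x + y - (closest_point S x + closest_point S y)) \<bullet> w = 0"
      using orth[of w x] orth[of w y] by (simp add: algebra_simps)
  qed
  show "closest_point S (c *\<^sub>R x) = c *\<^sub>R closest_point S x" for c x
  proof (rule closest_point_subspace_eqI[OF assms subspace_scale[OF assms p]])
    fix w assume "w \<in> S"
    then show "(c *\<^sub>R x - c *\<^sub>R closest_point S x) \<bullet> w = 0"
      using orth[of w x] by (simp flip: scaleR_diff_right)
  qed
qed

lemma closest_point_subspace_selfadjoint:
  fixes S :: "'a::euclidean_space set"
  assumes "subspace S"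
  shows "closest_point S x \<bullet> y = x \<bullet> closest_point S y"
proof -
  have p: "closest_point S x \<in> S" for x
    using closed_subspace[OF assms] subspace_0[OF assms] by (auto intro: closest_point_in_set)
  show ?thesis
    using closest_point_subspace_orthogonal[OF assms p, of x y]
      closest_point_subspace_orthogonal[OF assms p, of y x]
    by (simp add: algebra_simps inner_commute)
qed

section \<open>The linear part of the relaxed projection onto the affine set\<close>

lemma subspace_null:
  assumes "linear A"
  shows "subspace {x. A x = 0}"
  using assms by (auto simp: subspace_def linear_0 linear_add linear_scale)

lemma linear_lin_part:
  assumes "linear A"
  shows "linear (lin_part A \<alpha>)"
  using linear_closest_point_subspace[OF subspace_null[OF assms]]
  by (intro linearI) (auto simp: lin_part_def linear_add linear_scale algebra_simps)

lemma lin_part_selfadjoint: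
  assumes "linear A"
  shows "lin_part A \<alpha> x \<bullet> y = x \<bullet> lin_part A \<alpha> y"
  using closest_point_subspace_selfadjoint[OF subspace_null[OF assms]]
  by (simp add: lin_part_def inner_left_distrib inner_right_distrib)

lemma lin_part_null:
  assumes "A x = 0"
  shows "lin_part A \<alpha> x = x"
  using assms by (simp add: lin_part_def closest_point_self algebra_simps)

lemma lin_part_range_adjoint:
  fixes A :: "'a::euclidean_space \<Rightarrow> 'b::euclidean_space"
  assumes "linear A" "x \<in> range (adjoint A)"
  shows "lin_part A \<alpha> x = (1 - \<alpha>) *\<^sub>R x"
proof -
  \<comment> \<open>The inner product of \<open>adjoint A u\<close> with a null vector
    \<open>w\<close> is that of \<open>u\<close> with \<open>A w = 0\<close>, so \<open>x\<close> is
    orthogonal to the nullspace.\<close>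
  have "closest_point {z. A z = 0} x = 0"
    using assms by (intro closest_point_subspace_eqI subspace_null)
      (auto simp: linear_0 inner_commute adjoint_works)
  then show ?thesis
    by (simp add: lin_part_def)
qed

text \<open>The affine set is the nullspace shifted by a particular solution \<open>d\<close>, so
  its projection is \<open>d + ?N (z - d)\<close>; the terms in \<open>d\<close> cancel in the
  difference.\<close>

lemma relaxed_proj_affine_diff:
  fixes A :: "'a::euclidean_space \<Rightarrow> 'b::euclidean_space"
  assumes "linear A" "{x. A x = b} \<noteq> {}"
  shows "relaxed_proj \<alpha> {z. A z = b} x - relaxed_proj \<alpha> {z. A z = b} y = lin_part A \<alpha> (x - y)"
proof -
  obtain d where d: "A d = b"
    using assms(2) by blast
  let ?N = "closest_point {z. A z = 0}"
  note lin = linear_closest_point_subspace[OF subspace_null[OF assms(1)]]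
  have D: "{z. A z = b} = (+) d ` {z. A z = 0}"
  proof (intro equalityI subsetI)
    fix z assume "z \<in> {z. A z = b}"
    then have "z = d + (z - d)" "z - d \<in> {z. A z = 0}"
      using d assms(1) by (auto simp: linear_diff)
    then show "z \<in> (+) d ` {z. A z = 0}"
      by blast
  qed (use d assms(1) in \<open>auto simp: linear_add\<close>)
  have proj: "closest_point {z. A z = b} z = d + ?N (z - d)" for z
    using closest_point_translation[of "{z. A z = 0}" d "z - d"] d
      closed_subspace[OF subspace_null[OF assms(1)]] subspace_imp_convex[OF subspace_null[OF assms(1)]]
      linear_0[OF assms(1)] unfolding D by auto
  show ?thesis
    unfolding relaxed_proj_def lin_part_def proj linear_diff[OF lin] by (simp add: algebra_simps)
qed

section \<open>Gradient and Bregman bounds of the GAP envelope\<close>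

text \<open>This is what the chain rule predicts: the self-adjoint
  \<open>lin_part A \<alpha>1\<close> is the gradient of the quadratic term and also the transposed
  derivative of the inner relaxed projection.\<close>

definition gap_gradient ::
  "('a::euclidean_space \<Rightarrow> 'b::euclidean_space) \<Rightarrow> 'b \<Rightarrow> 'a set \<Rightarrow> real \<Rightarrow> real \<Rightarrow> 'a \<Rightarrow> 'a" where
  "gap_gradient A b C \<alpha>1 \<alpha>2 x = lin_part A \<alpha>1 x
     - lin_part A \<alpha>1 (relaxed_proj \<alpha>2 C (relaxed_proj \<alpha>1 {z. A z = b} x))"

lemma gap_envelope_Bregman:
  fixes A :: "'a::euclidean_space \<Rightarrow> 'b::euclidean_space" and \<alpha>1 :: real
  assumes "C \<noteq> {}" "closed C" "convex C" "linear A" "{x. A x = b} \<noteq> {}" "0 \<le> \<alpha>2"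
  defines "F \<equiv> gap_envelope A b C \<alpha>1 \<alpha>2"
  defines "G \<equiv> gap_gradient A b C \<alpha>1 \<alpha>2"
  defines "P \<equiv> lin_part A \<alpha>1"
  shows "(P (x - y) \<bullet> (x - y) - (norm (P (x - y)))\<^sup>2) / 2 \<le> F x - F y - G y \<bullet> (x - y)"
    and "F x - F y - G y \<bullet> (x - y)
      \<le> (P (x - y) \<bullet> (x - y) - (1 - \<alpha>2) * (norm (P (x - y)))\<^sup>2) / 2"
proof -
  define T where "T = relaxed_proj \<alpha>1 {z. A z = b}"
  define B where "B = p_fun \<alpha>2 C (T x) - p_fun \<alpha>2 C (T y) - relaxed_proj \<alpha>2 C (T y) \<bullet> (T x - T y)"
  have T: "T x - T y = P (x - y)"
    unfolding T_def P_def by (rule relaxed_proj_affine_diff[OF assms(4,5)])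
  have lin: "P (x - y) = P x - P y"
    unfolding P_def by (rule linear_diff[OF linear_lin_part[OF assms(4)]])
  have adj: "P u \<bullet> v = u \<bullet> P v" for u v
    unfolding P_def by (rule lin_part_selfadjoint[OF assms(4)])
  have "G y \<bullet> (x - y) = P y \<bullet> (x - y) - relaxed_proj \<alpha>2 C (T y) \<bullet> P (x - y)"
    by (simp add: G_def gap_gradient_def T_def inner_diff_left adj flip: P_def)
  \<comment> \<open>Self-adjointness merges the two cross terms, so the Bregman distance of the
    quadratic term depends on \<open>x - y\<close> only.\<close>
  moreover have "P x \<bullet> x / 2 - P y \<bullet> y / 2 - P y \<bullet> (x - y) = P (x - y) \<bullet> (x - y) / 2"
    using adj[of x y] by (simp add: lin inner_commute algebra_simps field_simps)
  ultimately have eq: "F x - F y - G y \<bullet> (x - y) = P (x - y) \<bullet> (x - y) / 2 - B"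
    by (simp add: F_def gap_envelope_def B_def T flip: P_def T_def)
  show "(P (x - y) \<bullet> (x - y) - (norm (P (x - y)))\<^sup>2) / 2 \<le> F x - F y - G y \<bullet> (x - y)"
    and "F x - F y - G y \<bullet> (x - y)
      \<le> (P (x - y) \<bullet> (x - y) - (1 - \<alpha>2) * (norm (P (x - y)))\<^sup>2) / 2"
    unfolding eq using p_fun_Bregman[OF assms(1-3,6), where x = "T x" and y = "T y"]
    by (auto simp: T[symmetric] B_def[symmetric] diff_divide_distrib)
qed

lemma GDERIV_gap_envelope:
  fixes A :: "'a::euclidean_space \<Rightarrow> 'b::euclidean_space"
  assumes "C \<noteq> {}" "closed C" "convex C" "linear A" "{x. A x = b} \<noteq> {}" "0 \<le> \<alpha>2"
  shows "GDERIV (gap_envelope A b C \<alpha>1 \<alpha>2) y :> gap_gradient A b C \<alpha>1 \<alpha>2 y"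
proof -
  have "bounded_linear (lin_part A \<alpha>1)"
    by (rule linear_conv_bounded_linear[THEN iffD1, OF linear_lin_part[OF assms(4)]])
  then obtain K where K: "\<And>h. norm (lin_part A \<alpha>1 h) \<le> norm h * K"
    using bounded_linear.bounded by blast
  show ?thesis
  \<comment> \<open>Here \<open>K\<close> bounds the operator norm of
    \<open>lin_part A \<alpha>1\<close>. The inner product term costs \<open>K\<close>; the squared
    norm enters with coefficient between \<open>- 1\<close> and \<open>\<alpha>2 - 1\<close>, of
    absolute value at most \<open>1 + \<alpha>2\<close>.\<close>
  proof (rule GDERIV_quadratic_bound[where K = "(K + (1 + \<alpha>2) * K\<^sup>2) / 2"])
    fix x
    let ?h = "x - y"
    let ?Ph = "lin_part A \<alpha>1 ?h"
    have "\<bar>?Ph \<bullet> ?h\<bar> \<le> norm ?Ph * norm ?h"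
      by (rule Cauchy_Schwarz_ineq2)
    also have "\<dots> \<le> norm ?h * K * norm ?h"
      using K by (intro mult_right_mono) auto
    finally have 1: "\<bar>?Ph \<bullet> ?h\<bar> \<le> K * (norm ?h)\<^sup>2"
      by (simp add: power2_eq_square mult_ac)
    have "(norm ?Ph)\<^sup>2 \<le> (norm ?h * K)\<^sup>2"
      using K by (intro power_mono) auto
    then have 2: "(1 + \<alpha>2) * (norm ?Ph)\<^sup>2 \<le> (1 + \<alpha>2) * (K\<^sup>2 * (norm ?h)\<^sup>2)"
      using assms(6) by (intro mult_left_mono) (auto simp: power_mult_distrib mult.commute)
    have 3: "0 \<le> \<alpha>2 * (norm ?Ph)\<^sup>2" "0 \<le> (norm ?Ph)\<^sup>2"
      using assms(6) by auto
    define B where "B = gap_envelope A b C \<alpha>1 \<alpha>2 x - gap_envelope A b C \<alpha>1 \<alpha>2 y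
      - gap_gradient A b C \<alpha>1 \<alpha>2 y \<bullet> ?h"
    have "?Ph \<bullet> ?h - (norm ?Ph)\<^sup>2 \<le> 2 * B"
      and "2 * B \<le> ?Ph \<bullet> ?h - (norm ?Ph)\<^sup>2 + \<alpha>2 * (norm ?Ph)\<^sup>2"
      using gap_envelope_Bregman[OF assms, where x = x and y = y and ?\<alpha>1.0 = \<alpha>1]
      by (simp_all add: B_def left_diff_distrib)
    moreover have "(1 + \<alpha>2) * (norm ?Ph)\<^sup>2 = (norm ?Ph)\<^sup>2 + \<alpha>2 * (norm ?Ph)\<^sup>2"
      by (simp add: distrib_right)
    ultimately have "2 * \<bar>B\<bar> \<le> K * (norm ?h)\<^sup>2 + (1 + \<alpha>2) * (K\<^sup>2 * (norm ?h)\<^sup>2)"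
      using 1 2 3 by linarith
    then have "\<bar>B\<bar> \<le> (K + (1 + \<alpha>2) * K\<^sup>2) / 2 * (norm ?h)\<^sup>2"
      by (simp add: algebra_simps)
    then show "\<bar>gap_envelope A b C \<alpha>1 \<alpha>2 x - gap_envelope A b C \<alpha>1 \<alpha>2 y
        - gap_gradient A b C \<alpha>1 \<alpha>2 y \<bullet> ?h\<bar> \<le> (K + (1 + \<alpha>2) * K\<^sup>2) / 2 * (norm ?h)\<^sup>2"
      by (simp only: B_def)
  qed
qed

theorem proposition5p4:
  fixes C :: "'a::euclidean_space set"
    and A :: "'a \<Rightarrow> 'b::euclidean_space"
    and b :: 'b
    and \<alpha>1 \<alpha>2 :: real
  assumes "C \<noteq> {}" and "closed C" and "convex C"
    and "linear A"
    and "{x. A x = b} \<noteq> {}"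
    and "\<alpha>1 \<in> {0<..2}" and "\<alpha>2 \<in> {0<..2}"
  shows "convex_on {x. A x = 0} (gap_envelope A b C \<alpha>1 \<alpha>2) \<and>
         smooth_restricted \<alpha>2 {x. A x = 0} (gap_envelope A b C \<alpha>1 \<alpha>2) \<and>
         (\<alpha>1 \<in> {1..2} \<longrightarrow>
           concave_on (range (adjoint A)) (gap_envelope A b C \<alpha>1 \<alpha>2) \<and>
           smooth_restricted (\<alpha>1 * (\<alpha>1 - 1)) (range (adjoint A)) (gap_envelope A b C \<alpha>1 \<alpha>2))"
proof -
  define F G where "F = gap_envelope A b C \<alpha>1 \<alpha>2" and "G = gap_gradient A b C \<alpha>1 \<alpha>2"
  let ?B = "\<lambda>x y. F x - F y - G y \<bullet> (x - y)"
  let ?N = "{x. A x = 0}" and ?R = "range (adjoint A)"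
  have \<alpha>2: "0 \<le> \<alpha>2" "\<alpha>2 \<le> 2"
    using assms(7) by auto
  have deriv: "GDERIV F x :> G x" for x
    unfolding F_def G_def using assms(1-5) \<alpha>2(1) by (rule GDERIV_gap_envelope)
  note breg = gap_envelope_Bregman[OF assms(1-5) \<alpha>2(1), where ?\<alpha>1.0 = \<alpha>1, folded F_def G_def]
  have N: "subspace ?N"
    using assms(4) by (rule subspace_null)
  have R: "subspace ?R"
    using adjoint_linear[OF assms(4)] by (intro linear_subspace_image) auto

  have null: "0 \<le> ?B x y" "?B x y \<le> \<alpha>2 / 2 * (norm (x - y))\<^sup>2" if "x \<in> ?N" "y \<in> ?N" for x y
  proof -
    have "A (x - y) = 0"
      using subspace_diff[OF N that] by simp
    \<comment> \<open>With \<open>P h = h\<close> the lower bound collapses to 0 and the factor in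
      the upper one becomes \<open>1 - (1 - \<alpha>2) = \<alpha>2\<close>.\<close>
    from lin_part_null[of A, OF this, of \<alpha>1] breg[of x y]
    show "0 \<le> ?B x y" "?B x y \<le> \<alpha>2 / 2 * (norm (x - y))\<^sup>2"
      by (auto simp: power2_norm_eq_inner left_diff_distrib)
  qed

  have range: "- (\<alpha>1 * (\<alpha>1 - 1) / 2) * (norm (x - y))\<^sup>2 \<le> ?B x y" "?B x y \<le> 0"
    if "\<alpha>1 \<in> {1..2}" "x \<in> ?R" "y \<in> ?R" for x y
  proof -
    let ?s = "1 - \<alpha>1" and ?n = "(norm (x - y))\<^sup>2"
    have "lin_part A \<alpha>1 (x - y) = ?s *\<^sub>R (x - y)"
      using subspace_diff[OF R that(2,3)] by (rule lin_part_range_adjoint[OF assms(4)])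
    then have B: "(?s - ?s\<^sup>2) / 2 * ?n \<le> ?B x y" "?B x y \<le> (?s - (1 - \<alpha>2) * ?s\<^sup>2) / 2 * ?n"
      using breg[of x y] by (simp_all add: power_mult_distrib power2_norm_eq_inner left_diff_distrib
          mult.assoc)
    \<comment> \<open>The smoothness constant comes from \<open>?s * (1 - ?s)\<close> with
      \<open>1 - ?s = \<alpha>1\<close>.\<close>
    have "(?s - ?s\<^sup>2) / 2 = - (\<alpha>1 * (\<alpha>1 - 1) / 2)"
      by (simp add: power2_eq_square field_simps)
    with B(1) show "- (\<alpha>1 * (\<alpha>1 - 1) / 2) * ?n \<le> ?B x y"
      by simp
    \<comment> \<open>The regrouping makes both signs visible: \<open>?s\<close> lies in
      \<open>[-1, 0]\<close> because \<open>\<alpha>1\<close> lies in \<open>[1, 2]\<close>, and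
      \<open>2 - \<alpha>2\<close> is nonnegative.\<close>
    have "?s - (1 - \<alpha>2) * ?s\<^sup>2 = ?s * (1 + ?s) - (2 - \<alpha>2) * ?s\<^sup>2"
      by (simp add: power2_eq_square algebra_simps)
    also have "\<dots> \<le> 0 - 0"
      using that(1) \<alpha>2 by (intro diff_mono mult_nonpos_nonneg mult_nonneg_nonneg) auto
    finally have "(?s - (1 - \<alpha>2) * ?s\<^sup>2) / 2 * ?n \<le> 0"
      by (intro mult_nonpos_nonneg) auto
    with B(2) show "?B x y \<le> 0"
      by linarith
  qed

  have "convex_on ?N F"
    using null by (intro convex_on_Bregman_nonneg[where G = G] subspace_imp_convex N)
  moreover have "smooth_restricted \<alpha>2 ?N F"
    unfolding smooth_restricted_def
  proof (intro conjI exI[of _ G] allI ballI deriv \<alpha>2 null)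
    fix x y assume "x \<in> ?N" "y \<in> ?N"
    moreover have "- (\<alpha>2 / 2) * (norm (x - y))\<^sup>2 \<le> 0"
      using \<alpha>2 by simp
    ultimately show "- (\<alpha>2 / 2) * (norm (x - y))\<^sup>2 \<le> ?B x y"
      using null(1) order_trans by blast
  qed
  moreover have "concave_on ?R F" if "\<alpha>1 \<in> {1..2}"
    unfolding concave_on_def
  \<comment> \<open>The Bregman distance changes sign with the function, so the nonpositive one of
    \<open>F\<close> gives convexity of \<open>- F\<close>.\<close>
  proof (rule convex_on_Bregman_nonneg[where G = "\<lambda>x. - G x"])
    fix x y assume "x \<in> ?R" "y \<in> ?R"
    then show "0 \<le> - F x - - F y - - G y \<bullet> (x - y)"
      using range(2)[OF that, of x y] by simp
  qed (rule subspace_imp_convex[OF R])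
  moreover have "smooth_restricted (\<alpha>1 * (\<alpha>1 - 1)) ?R F" if \<alpha>1: "\<alpha>1 \<in> {1..2}"
  proof -
    have \<beta>: "0 \<le> \<alpha>1 * (\<alpha>1 - 1)"
      using \<alpha>1 by simp
    show ?thesis
      unfolding smooth_restricted_def
    proof (intro conjI exI[of _ G] allI ballI deriv \<beta> range[OF \<alpha>1])
      fix x y assume "x \<in> ?R" "y \<in> ?R"
      moreover have "0 \<le> \<alpha>1 * (\<alpha>1 - 1) / 2 * (norm (x - y))\<^sup>2"
        using \<beta> by simp
      ultimately show "?B x y \<le> \<alpha>1 * (\<alpha>1 - 1) / 2 * (norm (x - y))\<^sup>2"
        using range(2)[OF \<alpha>1] order_trans by blast
    qed
  qed
  ultimately show ?thesis
    by (simp add: F_def)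
qed

end
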